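(* Let $N\ge 1$ be an integer, let $P_T>0$, $R_s>0$, $\eta>0$, $V_0>0$ be real constants, and let $h_1,\ldots,h_N\ge 0$ be real numbers, not all zero. Consider the optimization problem $$\mathrm{(P2)}:\quad \max_{s_1\ge 0,\ldots,s_N\ge 0}\ \exp\left(\frac{\sqrt{2R_s}\,\sum_{n=1}^{N} s_n h_n}{\eta V_0}\right)\quad\text{subject to}\quad \sum_{n=1}^{N} s_n^2\le P_T .$$ Then the optimal solution to (P2) is given by $$s_n = h_n\sqrt{\frac{P_T}{\sum_{k=1}^{N} h_k^2}},\qquad n=1,\ldots,N .$$
   Context: In the underlying wireless power transfer model, $s_n\ge 0$ is the amplitude of the $n$-th transmitted sinewave (the decision variable), $h_n$ is the amplitude (modulus) of the channel frequency response at the $n$-th frequency, $P_T$ is the transmit power limit, $R_s$ is the antenna resistance, and $\eta$, $V_0$ are the ideality factor and thermal voltage of the diode. *)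

theory Defs
  imports "HOL-Analysis.Analysis"
begin

text \<open>The index type \<open>'n\<close> plays the role of the index set \<open>{1, ..., N}\<close> with
  \<open>N = CARD('n) \<ge> 1\<close>.\<close>

definition P2_objective :: "real \<Rightarrow> real \<Rightarrow> real \<Rightarrow> real ^ 'n \<Rightarrow> real ^ 'n \<Rightarrow> real" where
  "P2_objective R\<^sub>s \<eta> V\<^sub>0 h s = exp (sqrt (2 * R\<^sub>s) * (\<Sum>n\<in>UNIV. s $ n * h $ n) / (\<eta> * V\<^sub>0))"

definition P2_feasible :: "real \<Rightarrow> real ^ 'n \<Rightarrow> bool" where
  "P2_feasible P\<^sub>T s \<longleftrightarrow> (\<forall>n. s $ n \<ge> 0) \<and> (\<Sum>n\<in>UNIV. (s $ n)\<^sup>2) \<le> P\<^sub>T"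

definition P2_optimal :: "real \<Rightarrow> real \<Rightarrow> real \<Rightarrow> real \<Rightarrow> real ^ 'n \<Rightarrow> real ^ 'n \<Rightarrow> bool" where
  "P2_optimal P\<^sub>T R\<^sub>s \<eta> V\<^sub>0 h s \<longleftrightarrow> is_arg_max (P2_objective R\<^sub>s \<eta> V\<^sub>0 h) (P2_feasible P\<^sub>T) s"

end

theory Submission
  imports Defs
begin

text \<open>The exponential is increasing, so one maximises the linear form \<open>s \<bullet> h\<close> over part of a ball
  of radius \<open>sqrt P\<^sub>T\<close>. With \<open>c = sqrt (P\<^sub>T / (h \<bullet> h))\<close>, expanding the square of the distance from
  \<open>s\<close> to \<open>c h\<close> bounds it by \<open>2 c\<close> times the gap between the values of the form at \<open>c h\<close> and \<open>s\<close>;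
  this yields both the optimality of \<open>c h\<close> and its uniqueness.\<close>

text \<open>The factor \<open>sqrt (2 * R\<^sub>s) / (\<eta> * V\<^sub>0)\<close> is strictly
  positive, so comparisons transfer both ways; uniqueness uses the forward direction.\<close>

lemma P2_objective_le_iff:
  fixes h s t :: "real ^ 'n"
  assumes "R\<^sub>s > 0" "\<eta> > 0" "V\<^sub>0 > 0"
  shows "P2_objective R\<^sub>s \<eta> V\<^sub>0 h s \<le> P2_objective R\<^sub>s \<eta> V\<^sub>0 h t \<longleftrightarrow> s \<bullet> h \<le> t \<bullet> h"
proof -
  have "\<eta> * V\<^sub>0 > 0"
    using assms by simp
  then show ?thesis
    using assms(1) by (simp add: P2_objective_def inner_vec_def divide_le_cancel)
qed

lemma P2_feasible_iff:
  fixes s :: "real ^ 'n"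
  shows "P2_feasible P\<^sub>T s \<longleftrightarrow> (\<forall>n. s $ n \<ge> 0) \<and> s \<bullet> s \<le> P\<^sub>T"
  by (simp add: P2_feasible_def inner_vec_def power2_eq_square)

text \<open>Both squared norms in the expansion are at most \<open>P\<close>, and
  \<open>2 * P\<close> equals \<open>2 * c * ((c *\<^sub>R h) \<bullet> h)\<close>.\<close>

lemma dist_square_le_inner_gap:
  fixes s h :: "'a::real_inner"
  assumes "s \<bullet> s \<le> P" "c\<^sup>2 * (h \<bullet> h) = P"
  shows "(norm (s - c *\<^sub>R h))\<^sup>2 \<le> 2 * c * ((c *\<^sub>R h) \<bullet> h - s \<bullet> h)"
proof -
  have "(norm (s - c *\<^sub>R h))\<^sup>2 = s \<bullet> s - 2 * c * (s \<bullet> h) + c\<^sup>2 * (h \<bullet> h)"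
    unfolding power2_norm_eq_inner
    by (simp add: inner_diff_left inner_diff_right inner_commute power2_eq_square)
  with assms show ?thesis
    by (simp add: right_diff_distrib power2_eq_square)
qed

theorem proposition4p1:
  fixes P\<^sub>T R\<^sub>s \<eta> V\<^sub>0 :: real and h :: "real ^ 'n"
  assumes "P\<^sub>T > 0" and "R\<^sub>s > 0" and "\<eta> > 0" and "V\<^sub>0 > 0"
    and "\<forall>n. h $ n \<ge> 0" and "\<exists>n. h $ n \<noteq> 0"
  shows "\<forall>s. P2_optimal P\<^sub>T R\<^sub>s \<eta> V\<^sub>0 h s \<longleftrightarrow>
    (\<forall>n. s $ n = h $ n * sqrt (P\<^sub>T / (\<Sum>k\<in>UNIV. (h $ k)\<^sup>2)))"
proof
  fix s :: "real ^ 'n"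
  define c where "c = sqrt (P\<^sub>T / (h \<bullet> h))"
  have hh: "h \<bullet> h > 0"
    using assms(6) by (auto simp: vec_eq_iff)
  have c: "c > 0" and c2: "c\<^sup>2 * (h \<bullet> h) = P\<^sub>T"
    using hh assms(1) by (auto simp: c_def)
  \<comment> \<open>Scaling by \<open>c\<close> puts \<open>h\<close> on the sphere, so the power
    constraint holds with equality; the signs come from \<open>h\<close>.\<close>
  have feas: "P2_feasible P\<^sub>T (c *\<^sub>R h)"
    using assms(5) c c2 by (simp add: P2_feasible_iff power2_eq_square mult.assoc)
  have gap: "(norm (u - c *\<^sub>R h))\<^sup>2 \<le> 2 * c * ((c *\<^sub>R h) \<bullet> h - u \<bullet> h)"
    if "P2_feasible P\<^sub>T u" for u
    using that c2 by (intro dist_square_le_inner_gap) (auto simp: P2_feasible_iff)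
  have max: "u \<bullet> h \<le> (c *\<^sub>R h) \<bullet> h" if "P2_feasible P\<^sub>T u" for u
  proof -
    have "0 \<le> 2 * c * ((c *\<^sub>R h) \<bullet> h - u \<bullet> h)"
      using gap[OF that] zero_le_power2 order_trans by blast
    then show ?thesis
      using c by (simp add: zero_le_mult_iff)
  qed
  \<comment> \<open>\<open>is_arg_max\<close> only excludes strictly better points; linearity of the
    order turns this into an upper bound.\<close>
  have opt_iff: "P2_optimal P\<^sub>T R\<^sub>s \<eta> V\<^sub>0 h s \<longleftrightarrow>
      P2_feasible P\<^sub>T s \<and> (\<forall>u. P2_feasible P\<^sub>T u \<longrightarrow> u \<bullet> h \<le> s \<bullet> h)"
    unfolding P2_optimal_def is_arg_max_def
    using P2_objective_le_iff[OF assms(2-4)] by (metis not_less)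
  have "P2_optimal P\<^sub>T R\<^sub>s \<eta> V\<^sub>0 h s \<longleftrightarrow> s = c *\<^sub>R h"
  proof
    assume "P2_optimal P\<^sub>T R\<^sub>s \<eta> V\<^sub>0 h s"
    then have "P2_feasible P\<^sub>T s" and "(c *\<^sub>R h) \<bullet> h \<le> s \<bullet> h"
      using feas by (auto simp only: opt_iff)
    \<comment> \<open>Two maximisers have equal values, so the bound in \<open>gap\<close> collapses
      to zero.\<close>
    with max have "(c *\<^sub>R h) \<bullet> h - s \<bullet> h = 0"
      by (simp add: order_antisym)
    with gap[OF \<open>P2_feasible P\<^sub>T s\<close>] show "s = c *\<^sub>R h"
      by simp
  next
    assume "s = c *\<^sub>R h"
    then show "P2_optimal P\<^sub>T R\<^sub>s \<eta> V\<^sub>0 h s"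
      using feas max opt_iff by blast
  qed
  also have "\<dots> \<longleftrightarrow> (\<forall>n. s $ n = h $ n * sqrt (P\<^sub>T / (\<Sum>k\<in>UNIV. (h $ k)\<^sup>2)))"
    by (simp add: vec_eq_iff c_def inner_vec_def power2_eq_square mult.commute)
  finally show "P2_optimal P\<^sub>T R\<^sub>s \<eta> V\<^sub>0 h s \<longleftrightarrow>
      (\<forall>n. s $ n = h $ n * sqrt (P\<^sub>T / (\<Sum>k\<in>UNIV. (h $ k)\<^sup>2)))" .
qed

end
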